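(* Let $\mathfrak{P}_{\mathrm{sg}}=\mathfrak{P}_{\mathrm{sg}}(M,\sigma,\bar K)$ with $M,\sigma>0$, $\bar K\ge2$ fixed. Any bandit algorithm with worst-case regret $\mathcal R_T=\tilde O(\sqrt T)$ satisfies $\mathcal S_T=\tilde\Theta(T)$. In particular, any minimax regret-optimal algorithm, i.e. one attaining $\mathcal R_T=\Theta(\sqrt T)$, satisfies $\mathcal S_T=\Theta(T)$.
   Context: Stochastic multi-armed bandit. There are $K$ arms; for each arm $i\in[K]=\{1,\dots,K\}$, $(X^i_s)_{s\ge1}$ is an i.i.d. reward sequence with law $\nu_i$, independent across arms; $\nu=(\nu_1,\dots,\nu_K)$ is the (unknown) bandit instance. For a horizon $T$, an algorithm selects at each time $t\in[T]$ an arm $A_t\sim\pi_t(\cdot\mid\mathcal H_{t-1})$, where $\mathcal H_{t-1}=(A_1,r_1,\dots,A_{t-1},r_{t-1})$ is the observed history, $\pi_t(\cdot\mid \mathcal H_{t-1})$ is a distribution on $[K]$, $N_{i,t}=\sum_{s=1}^t\mathbf 1\{A_s=i\}$, and $r_t=X^{A_t}_{N_{A_t,t}}$. An algorithm thus specifies decision rules $(\pi_t)_{t\in[T]}$ for every horizon $T$ and every number of arms $K$ (the rules may depend on $T$, $K$). Let $\mu_i$ be the mean of $\nu_i$, $\Delta_i=\max_j\mu_j-\mu_i$. Regret: $R_T(\nu)=\sum_{i=1}^K\Delta_i\,\mathbb E[N_{i,T}]$. Allocation variability: $S_T(\nu)=\max_{i\in[K]}\sqrt{\operatorname{Var}(N_{i,T})}$.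 $\mathfrak{P}_{\mathrm{sg}}(M,\sigma,\bar K)$ is the class of instances $\nu=(\nu_1,\dots,\nu_K)$ with $2\le K\le\bar K$ such that each $\nu_i$ has mean $\mu_i\in[-M,M]$ and is $\sigma$-sub-Gaussian. $\mathcal R_T=\sup_{\nu\in\mathfrak{P}_{\mathrm{sg}}}R_T(\nu)$, $\mathcal S_T=\sup_{\nu\in\mathfrak{P}_{\mathrm{sg}}}S_T(\nu)$. Standing assumptions on algorithms: (i) if $\nu_i=\nu_j$ for some $i\ne j$ then $\mathbb E[N_{i,T}]=\mathbb E[N_{j,T}]$; (ii) for $T\ge K$, $\mathbb E[N_{i,T}]\ge1$ for each arm $i$. Asymptotic notation is as $T\to\infty$; $\tilde O,\tilde\Omega,\tilde\Theta$ suppress factors polylogarithmic in $T$. *)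

theory Defs
  imports "HOL-Probability.Probability" "HOL-Library.Landau_Symbols"
begin

section \<open>Bandit instances\<close>

text \<open>
  An instance is a pair \<open>(K, \<nu>)\<close> of a number of arms and the reward laws of the arms
  \<open>1, \<dots>, K\<close>; the values of \<open>\<nu>\<close> outside \<open>{1..K}\<close> are irrelevant.
\<close>

type_synonym bandit_instance = "nat \<times> (nat \<Rightarrow> real measure)"

definition mean :: "real measure \<Rightarrow> real" where
  "mean N = (\<integral>x. x \<partial>N)"

definition sub_Gaussian :: "real \<Rightarrow> real measure \<Rightarrow> bool" where
  "sub_Gaussian \<sigma> N \<longleftrightarrow>
     prob_space N \<and> sets N = sets borel \<and> integrable N (\<lambda>x. x) \<and>
     (\<forall>l::real. integrable N (\<lambda>x. exp (l * (x - mean N))) \<and>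
                (\<integral>x. exp (l * (x - mean N)) \<partial>N) \<le> exp (l\<^sup>2 * \<sigma>\<^sup>2 / 2))"

definition sub_Gaussian_class :: "real \<Rightarrow> real \<Rightarrow> nat \<Rightarrow> bandit_instance set" where
  "sub_Gaussian_class M \<sigma> Kbar =
     {(K, \<nu>). 2 \<le> K \<and> K \<le> Kbar \<and>
              (\<forall>i\<in>{1..K}. mean (\<nu> i) \<in> {-M..M} \<and> sub_Gaussian \<sigma> (\<nu> i))}"

definition gap :: "nat \<Rightarrow> (nat \<Rightarrow> real measure) \<Rightarrow> nat \<Rightarrow> real" where
  "gap K \<nu> i = Max ((\<lambda>j. mean (\<nu> j)) ` {1..K}) - mean (\<nu> i)"


section \<open>Algorithms and the law of their play\<close>

text \<open>
  \<open>\<pi> T K t h\<close> is the distribution of the arm selected at time \<open>t\<close>, for horizon \<open>T\<close> and \<open>K\<close> arms,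
  given the observed history \<open>h = [(A\<^sub>1, r\<^sub>1), \<dots>, (A\<^sub>t\<^sub>-\<^sub>1, r\<^sub>t\<^sub>-\<^sub>1)]\<close>.
\<close>

type_synonym history = "(nat \<times> real) list"

type_synonym bandit_algorithm = "nat \<Rightarrow> nat \<Rightarrow> nat \<Rightarrow> history \<Rightarrow> nat pmf"

text \<open>
  Every decision rule is a stochastic kernel into \<open>{1..K}\<close>. Since arms are discrete, measurability
  in the history amounts to measurability in the reward vector for each fixed sequence of arms.
\<close>

definition is_bandit_algorithm :: "bandit_algorithm \<Rightarrow> bool" where
  "is_bandit_algorithm \<pi> \<longleftrightarrow>
     (\<forall>T K t as. 1 \<le> K \<longrightarrow> t \<in> {1..T} \<longrightarrow> set as \<subseteq> {1..K} \<longrightarrow> length as = t - 1 \<longrightarrow>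
        (\<forall>r. set_pmf (\<pi> T K t (zip as (map r [0..<t - 1]))) \<subseteq> {1..K}) \<and>
        (\<forall>i\<in>{1..K}. (\<lambda>r. pmf (\<pi> T K t (zip as (map r [0..<t - 1]))) i)
                        \<in> borel_measurable (\<Pi>\<^sub>M s\<in>{0..<t - 1}. borel)))"

text \<open>
  The table of rewards \<open>X\<^sup>i\<^sub>s\<close>, stored at index \<open>(i, s)\<close>: all entries are independent, and the
  entries of arm \<open>i\<close> have law \<open>\<nu> i\<close>.
\<close>

definition reward_table :: "nat \<Rightarrow> (nat \<Rightarrow> real measure) \<Rightarrow> (nat \<times> nat \<Rightarrow> real) measure" where
  "reward_table K \<nu> = (\<Pi>\<^sub>M (i, s)\<in>{1..K} \<times> {1..}. \<nu> i)"

definition pulls :: "nat \<Rightarrow> nat list \<Rightarrow> nat" where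
  "pulls i as = count_list as i"

text \<open>
  The history after \<open>t\<close> rounds for a fixed reward table \<open>x\<close>; the \<open>n\<close>-th pull of an arm reveals the
  \<open>n\<close>-th entry of its row.
\<close>

primrec play :: "(nat \<Rightarrow> history \<Rightarrow> nat pmf) \<Rightarrow> (nat \<times> nat \<Rightarrow> real) \<Rightarrow> nat \<Rightarrow> history pmf" where
  "play \<rho> x 0 = return_pmf []"
| "play \<rho> x (Suc t) =
     do { h \<leftarrow> play \<rho> x t;
          a \<leftarrow> \<rho> (Suc t) h;
          return_pmf (h @ [(a, x (a, Suc (pulls a (map fst h))))]) }"

text \<open>
  The joint law of \<open>(A\<^sub>1, \<dots>, A\<^sub>T)\<close>: draw the reward table, then play against it. The first bind is
  that of the Giry monad.
\<close>

definition arms_law :: "bandit_algorithm \<Rightarrow> nat \<Rightarrow> nat \<Rightarrow> (nat \<Rightarrow> real measure) \<Rightarrow> nat list measure" where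
  "arms_law \<pi> T K \<nu> =
     reward_table K \<nu> \<bind> (\<lambda>x. measure_pmf (map_pmf (map fst) (play (\<pi> T K) x T)))"

definition expected_pulls :: "bandit_algorithm \<Rightarrow> nat \<Rightarrow> nat \<Rightarrow> (nat \<Rightarrow> real measure) \<Rightarrow> nat \<Rightarrow> real" where
  "expected_pulls \<pi> T K \<nu> i =
     prob_space.expectation (arms_law \<pi> T K \<nu>) (\<lambda>as. real (pulls i as))"

definition variance_pulls :: "bandit_algorithm \<Rightarrow> nat \<Rightarrow> nat \<Rightarrow> (nat \<Rightarrow> real measure) \<Rightarrow> nat \<Rightarrow> real" where
  "variance_pulls \<pi> T K \<nu> i =
     prob_space.variance (arms_law \<pi> T K \<nu>) (\<lambda>as. real (pulls i as))"


section \<open>Regret and allocation variability\<close>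

definition regret :: "bandit_algorithm \<Rightarrow> nat \<Rightarrow> nat \<Rightarrow> (nat \<Rightarrow> real measure) \<Rightarrow> real" where
  "regret \<pi> T K \<nu> = (\<Sum>i\<in>{1..K}. gap K \<nu> i * expected_pulls \<pi> T K \<nu> i)"

definition variability :: "bandit_algorithm \<Rightarrow> nat \<Rightarrow> nat \<Rightarrow> (nat \<Rightarrow> real measure) \<Rightarrow> real" where
  "variability \<pi> T K \<nu> = Max ((\<lambda>i. sqrt (variance_pulls \<pi> T K \<nu> i)) ` {1..K})"

text \<open>
  For \<^term>\<open>is_bandit_algorithm \<pi>\<close> the suprema are over bounded sets of reals: on \<^term>\<open>sub_Gaussian_class M \<sigma> Kbar\<close> the regret is at
  most \<open>2 * M * T\<close>, and the variability is at most \<open>T\<close>.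
\<close>

definition worst_regret :: "bandit_instance set \<Rightarrow> bandit_algorithm \<Rightarrow> nat \<Rightarrow> real" where
  "worst_regret \<PP> \<pi> T = (SUP (K, \<nu>)\<in>\<PP>. regret \<pi> T K \<nu>)"

definition worst_variability :: "bandit_instance set \<Rightarrow> bandit_algorithm \<Rightarrow> nat \<Rightarrow> real" where
  "worst_variability \<PP> \<pi> T = (SUP (K, \<nu>)\<in>\<PP>. variability \<pi> T K \<nu>)"


section \<open>Standing assumptions on algorithms\<close>

definition treats_identical_arms_equally :: "bandit_instance set \<Rightarrow> bandit_algorithm \<Rightarrow> bool" where
  "treats_identical_arms_equally \<PP> \<pi> \<longleftrightarrow>
     (\<forall>(K, \<nu>)\<in>\<PP>. \<forall>T. \<forall>i\<in>{1..K}. \<forall>j\<in>{1..K}. i \<noteq> j \<longrightarrow> \<nu> i = \<nu> j \<longrightarrow>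
        expected_pulls \<pi> T K \<nu> i = expected_pulls \<pi> T K \<nu> j)"

definition pulls_every_arm :: "bandit_instance set \<Rightarrow> bandit_algorithm \<Rightarrow> bool" where
  "pulls_every_arm \<PP> \<pi> \<longleftrightarrow>
     (\<forall>(K, \<nu>)\<in>\<PP>. \<forall>T\<ge>K. \<forall>i\<in>{1..K}. 1 \<le> expected_pulls \<pi> T K \<nu> i)"


section \<open>Asymptotics up to polylogarithmic factors\<close>

definition soft_O :: "(nat \<Rightarrow> real) \<Rightarrow> (nat \<Rightarrow> real) set" where
  "soft_O g = {f. \<exists>k::nat. f \<in> O(\<lambda>T. g T * ln (real T) ^ k)}"

definition soft_Omega :: "(nat \<Rightarrow> real) \<Rightarrow> (nat \<Rightarrow> real) set" where
  "soft_Omega g = {f. \<exists>k::nat. f \<in> \<Omega>(\<lambda>T. g T / ln (real T) ^ k)}"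

definition soft_Theta :: "(nat \<Rightarrow> real) \<Rightarrow> (nat \<Rightarrow> real) set" where
  "soft_Theta g = soft_O g \<inter> soft_Omega g"

end

theory Submission
  imports Defs "HOL-Real_Asymp.Real_Asymp"
begin

text \<open>
  Consider two Gaussian arms with means \<open>\<theta>\<close> and \<open>0\<close>, and let \<open>E(\<theta>)\<close> be the expected number of pulls of
  the second arm. By symmetry \<open>E(0) = T / 2\<close>, while regret at most \<open>R\<close> forces \<open>E(\<Delta>) \<le> T / 8\<close> for
  \<open>\<Delta> = 8 R / T\<close>. Go from \<open>0\<close> to \<open>\<Delta>\<close> in \<open>m\<close> steps of length at most \<open>\<sigma> / sqrt T\<close>. Neighbouring instances
  have bounded chi-square divergence, so by the Hammersley--Chapman--Robbins inequality a single
  step changes \<open>E\<close> by at most a constant times the standard deviation of the number of pulls. Hence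
  the variability is at least of order \<open>T / m\<close>, and \<open>m\<close> is polylogarithmic (bounded, if \<open>R\<close> is of order
  \<open>sqrt T\<close>). A direct change of measure from \<open>0\<close> to \<open>\<Delta>\<close> would instead lose a factor
  exponential in \<open>m\<^sup>2\<close>.
\<close>

section \<open>The law of the arms\<close>

definition observed :: "(nat \<times> nat \<Rightarrow> real) \<Rightarrow> nat list \<Rightarrow> history" where
  "observed x as =
     zip as (map (\<lambda>s. x (as ! s, Suc (pulls (as ! s) (take s as)))) [0..<length as])"

text \<open>Once the table is fixed, the arms determine the rewards, and
  \<open>observed x as\<close> rebuilds the history. Keeping only the arms confines the process to
  the finite set \<open>arm_seqs K t\<close>, so laws become finite sums of point masses.\<close>

primrec run :: "(nat \<Rightarrow> history \<Rightarrow> nat pmf) \<Rightarrow> (nat \<times> nat \<Rightarrow> real) \<Rightarrow> nat \<Rightarrow> nat list pmf" where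
  "run \<rho> x 0 = return_pmf []"
| "run \<rho> x (Suc t) =
     do { as \<leftarrow> run \<rho> x t;
          a \<leftarrow> \<rho> (Suc t) (observed x as);
          return_pmf (as @ [a]) }"

definition arm_seqs :: "nat \<Rightarrow> nat \<Rightarrow> nat list set" where
  "arm_seqs K t = {as. set as \<subseteq> {1..K} \<and> length as = t}"

lemma finite_arm_seqs [simp]: "finite (arm_seqs K t)"
  unfolding arm_seqs_def by (rule finite_lists_length_eq) simp

lemma pulls_le_length: "pulls i as \<le> length as"
  by (simp add: pulls_def count_le_length)

lemma map_fst_observed [simp]: "map fst (observed x as) = as"
  by (simp add: observed_def)

lemma observed_snoc:
  "observed x (as @ [a]) = observed x as @ [(a, x (a, Suc (pulls a as)))]"
  by (auto simp: observed_def nth_append intro!: arg_cong2[where f = zip])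

text \<open>By \<open>observed_snoc\<close>, appending an arm to the list appends exactly the pair
  that \<open>play\<close> records, so the two recursions match round by round.\<close>

lemma play_eq_run: "play \<rho> x t = map_pmf (observed x) (run \<rho> x t)"
proof (induction t)
  case 0
  then show ?case by (simp add: observed_def)
next
  case (Suc t)
  then show ?case
    by (simp add: map_pmf_def bind_assoc_pmf bind_return_pmf observed_snoc map_fst_observed[unfolded map_pmf_def])
qed

lemma map_fst_play: "map_pmf (map fst) (play \<rho> x t) = run \<rho> x t"
  by (simp add: play_eq_run pmf.map_comp o_def)

lemma is_bandit_algorithmD:
  assumes "is_bandit_algorithm \<pi>" "1 \<le> K" "t < T" "as \<in> arm_seqs K t"
  shows "set_pmf (\<pi> T K (Suc t) (observed x as)) \<subseteq> {1..K}"
    and "i \<in> {1..K} \<Longrightarrow> (\<lambda>r. pmf (\<pi> T K (Suc t) (zip as (map r [0..<t]))) i)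
                        \<in> borel_measurable (\<Pi>\<^sub>M s\<in>{0..<t}. borel)"
proof -
  have *: "(\<forall>r. set_pmf (\<pi> T K (Suc t) (zip as (map r [0..<t]))) \<subseteq> {1..K}) \<and>
        (\<forall>i\<in>{1..K}. (\<lambda>r. pmf (\<pi> T K (Suc t) (zip as (map r [0..<t]))) i)
                        \<in> borel_measurable (\<Pi>\<^sub>M s\<in>{0..<t}. borel))"
    using assms(1)[unfolded is_bandit_algorithm_def, rule_format, of K "Suc t" T as] assms(2-)
    by (simp add: arm_seqs_def)
  show "set_pmf (\<pi> T K (Suc t) (observed x as)) \<subseteq> {1..K}"
    using * assms(4) by (simp add: observed_def arm_seqs_def)
  show "(\<lambda>r. pmf (\<pi> T K (Suc t) (zip as (map r [0..<t]))) i)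
                        \<in> borel_measurable (\<Pi>\<^sub>M s\<in>{0..<t}. borel)" if "i \<in> {1..K}"
    using * that by blast
qed

lemma set_run:
  assumes "is_bandit_algorithm \<pi>" "1 \<le> K"
  shows "t \<le> T \<Longrightarrow> set_pmf (run (\<pi> T K) x t) \<subseteq> arm_seqs K t"
proof (induction t)
  case (Suc t)
  show ?case
  proof
    fix bs assume "bs \<in> set_pmf (run (\<pi> T K) x (Suc t))"
    then obtain as a where as: "as \<in> set_pmf (run (\<pi> T K) x t)"
      "a \<in> set_pmf (\<pi> T K (Suc t) (observed x as))" "bs = as @ [a]"
      by auto
    then have "as \<in> arm_seqs K t" using Suc by auto
    then show "bs \<in> arm_seqs K (Suc t)"
      using is_bandit_algorithmD(1)[OF assms, of t T as x] Suc.prems as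
      by (auto simp: arm_seqs_def)
  qed
qed (auto simp: arm_seqs_def)

text \<open>The list \<open>as @ [a]\<close> determines both \<open>as\<close> and \<open>a\<close>,
  so only one path of the bind contributes. Iterated, this writes the probability of an arm sequence
  as a product of decision probabilities.\<close>

lemma pmf_run_snoc:
  "pmf (run \<rho> x (Suc t)) (as @ [a]) =
     pmf (run \<rho> x t) as * pmf (\<rho> (Suc t) (observed x as)) a"
proof -
  have "pmf (do { a \<leftarrow> \<rho> (Suc t) (observed x bs); return_pmf (bs @ [a]) }) (as @ [a]) =
          pmf (\<rho> (Suc t) (observed x as)) a * indicator {as} bs" for bs
  proof (cases "bs = as")
    case True
    have "inj (\<lambda>a. as @ [a])" by (rule injI) simp
    then show ?thesis using True
      using pmf_map_inj'[of "\<lambda>a. as @ [a]" _ a]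
      by (simp add: map_pmf_def[symmetric])
  next
    case False
    then show ?thesis
      by (auto simp: pmf_eq_0_set_pmf)
  qed
  then have "pmf (run \<rho> x (Suc t)) (as @ [a]) =
     (\<integral>bs. pmf (\<rho> (Suc t) (observed x as)) a * indicator {as} bs \<partial>measure_pmf (run \<rho> x t))"
    by (simp add: pmf_bind)
  then show ?thesis by (simp add: measure_pmf_single)
qed

text \<open>An arm pulled at most \<open>s\<close> times before has its next reward at index at most
  \<open>s + 1\<close>, so \<open>T\<close> rounds never look beyond column \<open>T\<close> of the
  table.\<close>

lemma run_restrict:
  assumes "is_bandit_algorithm \<pi>" "1 \<le> K" "{1..K} \<times> {1..T} \<subseteq> J"
  shows "t \<le> T \<Longrightarrow> run (\<pi> T K) (restrict x J) t = run (\<pi> T K) x t"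
proof (induction t)
  case (Suc t)
  have "observed (restrict x J) as = observed x as" if "as \<in> arm_seqs K t" for as
  proof -
    have "(as ! s, Suc (pulls (as ! s) (take s as))) \<in> J" if "s < t" for s
    proof -
      have "pulls (as ! s) (take s as) \<le> s"
        using pulls_le_length[of "as ! s" "take s as"] by simp
      moreover have "as ! s \<in> {1..K}"
        using \<open>as \<in> _\<close> that by (auto simp: arm_seqs_def subset_iff)
      ultimately show ?thesis using assms(3) that Suc.prems by (auto simp: subset_iff)
    qed
    then show ?thesis
      using that by (auto simp: observed_def arm_seqs_def intro!: arg_cong2[where f = zip])
  qed
  then show ?case using Suc set_run[OF assms(1,2), of t T x]
    by (auto simp del: restrict_apply intro!: bind_pmf_cong)
qed simp

text \<open>Induction with the product formula \<open>pmf_run_snoc\<close>. The index set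
  \<open>J\<close> is left general so that the lemma serves both the infinite reward table and its
  restriction to \<open>T\<close> columns.\<close>

lemma measurable_pmf_run:
  assumes alg: "is_bandit_algorithm \<pi>" "1 \<le> K" and J: "{1..K} \<times> {1..T} \<subseteq> J"
    and N: "\<And>p. p \<in> {1..K} \<times> {1..T} \<Longrightarrow> sets (N p) = sets borel"
  shows "t \<le> T \<Longrightarrow> as \<in> arm_seqs K t \<Longrightarrow>
           (\<lambda>x. pmf (run (\<pi> T K) x t) as) \<in> borel_measurable (PiM J N)"
proof (induction t arbitrary: as)
  case 0
  then show ?case by simp
next
  case (Suc t bs)
  obtain as a where bs: "bs = as @ [a]" and as: "as \<in> arm_seqs K t" and a: "a \<in> {1..K}"
    using Suc.prems by (cases bs rule: rev_cases) (auto simp: arm_seqs_def)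
  \<comment> \<open>For a fixed arm sequence the rewards seen are fixed coordinates of
    \<open>x\<close>. Hence \<open>r\<close> is measurable, and the measurability demanded of the
    decision rules can be composed with it.\<close>
  define r where "r x = (\<lambda>s\<in>{0..<t}. x (as ! s, Suc (pulls (as ! s) (take s as))))"
    for x :: "nat \<times> nat \<Rightarrow> real"
  have "(\<lambda>x. x (as ! s, Suc (pulls (as ! s) (take s as)))) \<in> borel_measurable (PiM J N)"
    if "s \<in> {0..<t}" for s
  proof -
    have "pulls (as ! s) (take s as) \<le> s"
      using pulls_le_length[of "as ! s" "take s as"] by simp
    moreover have "as ! s \<in> {1..K}"
      using as that by (auto simp: arm_seqs_def subset_iff)
    ultimately have *: "(as ! s, Suc (pulls (as ! s) (take s as))) \<in> {1..K} \<times> {1..T}"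
      using that Suc.prems by auto
    from measurable_component_singleton[of "(as ! s, Suc (pulls (as ! s) (take s as)))" J N]
    show ?thesis using * J measurable_cong_sets[OF refl N[OF *], of "PiM J N"] by blast
  qed
  then have r: "r \<in> PiM J N \<rightarrow>\<^sub>M (\<Pi>\<^sub>M s\<in>{0..<t}. borel)"
    unfolding r_def by (rule measurable_restrict)
  have "observed x as = zip as (map (r x) [0..<t])" for x
    using as by (auto simp: observed_def r_def arm_seqs_def intro!: arg_cong2[where f = zip])
  then have "(\<lambda>x. pmf (\<pi> T K (Suc t) (observed x as)) a) \<in> borel_measurable (PiM J N)"
    using measurable_compose[OF r is_bandit_algorithmD(2)[OF alg _ as a, of T]] Suc.prems
    by simp
  then show ?case
    unfolding bs pmf_run_snoc using Suc as by (intro borel_measurable_times) auto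
qed

section \<open>Conditional expectations given the reward table\<close>

definition arms_mean ::
  "bandit_algorithm \<Rightarrow> nat \<Rightarrow> nat \<Rightarrow> (nat list \<Rightarrow> real) \<Rightarrow> (nat \<times> nat \<Rightarrow> real) \<Rightarrow> real" where
  "arms_mean \<pi> T K f x = (\<Sum>as\<in>arm_seqs K T. f as * pmf (run (\<pi> T K) x T) as)"

lemma arms_mean_measurable:
  assumes "is_bandit_algorithm \<pi>" "1 \<le> K" "{1..K} \<times> {1..T} \<subseteq> J"
    and "\<And>p. p \<in> {1..K} \<times> {1..T} \<Longrightarrow> sets (N p) = sets borel"
  shows "arms_mean \<pi> T K f \<in> borel_measurable (PiM J N)"
  unfolding arms_mean_def
  by (intro borel_measurable_sum borel_measurable_times borel_measurable_const
      measurable_pmf_run[OF assms]) auto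

lemma sum_pmf_run:
  assumes "is_bandit_algorithm \<pi>" "1 \<le> K"
  shows "(\<Sum>as\<in>arm_seqs K T. pmf (run (\<pi> T K) x T) as) = 1"
  using set_run[OF assms, of T T x] by (intro sum_pmf_eq_1) auto

lemma arms_mean_mono:
  assumes "\<And>as. as \<in> arm_seqs K T \<Longrightarrow> f as \<le> g as"
  shows "arms_mean \<pi> T K f x \<le> arms_mean \<pi> T K g x"
  unfolding arms_mean_def by (intro sum_mono mult_right_mono assms) auto

lemma arms_mean_const:
  assumes "is_bandit_algorithm \<pi>" "1 \<le> K"
  shows "arms_mean \<pi> T K (\<lambda>_. c) x = c"
  by (simp add: arms_mean_def sum_distrib_left[symmetric] sum_pmf_run[OF assms])

lemma arms_mean_bounds:
  assumes "is_bandit_algorithm \<pi>" "1 \<le> K"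
    and "\<And>as. as \<in> arm_seqs K T \<Longrightarrow> f as \<in> {a..b}"
  shows "arms_mean \<pi> T K f x \<in> {a..b}"
  using arms_mean_mono[of K T "\<lambda>_. a" f \<pi> x] arms_mean_mono[of K T f "\<lambda>_. b" \<pi> x] assms
  by (auto simp: arms_mean_const)

text \<open>Jensen's inequality for the square, obtained by expanding a nonnegative conditional
  variance.\<close>

lemma arms_mean_power2_le:
  assumes "is_bandit_algorithm \<pi>" "1 \<le> K"
  shows "(arms_mean \<pi> T K f x - c)\<^sup>2 \<le> arms_mean \<pi> T K (\<lambda>as. (f as - c)\<^sup>2) x"
proof -
  define m where "m = arms_mean \<pi> T K f x - c"
  have m: "(\<Sum>as\<in>arm_seqs K T. (f as - c) * pmf (run (\<pi> T K) x T) as) = m"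
    using sum_pmf_run[OF assms, of T x]
    by (simp add: m_def arms_mean_def left_diff_distrib sum_subtractf sum_distrib_left[symmetric])
  have "0 \<le> (\<Sum>as\<in>arm_seqs K T. (f as - c - m)\<^sup>2 * pmf (run (\<pi> T K) x T) as)"
    by (intro sum_nonneg) auto
  also have "\<dots> = (\<Sum>as\<in>arm_seqs K T. (f as - c)\<^sup>2 * pmf (run (\<pi> T K) x T) as
                    - 2 * m * ((f as - c) * pmf (run (\<pi> T K) x T) as) + m\<^sup>2 * pmf (run (\<pi> T K) x T) as)"
    by (intro sum.cong) (auto simp: power2_eq_square algebra_simps)
  also have "\<dots> = arms_mean \<pi> T K (\<lambda>as. (f as - c)\<^sup>2) x - m\<^sup>2"
    using sum_pmf_run[OF assms, of T x]
    by (simp add: arms_mean_def sum.distrib sum_subtractf sum_distrib_left[symmetric] m power2_eq_square)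
  finally show ?thesis by (simp add: m_def)
qed

text \<open>Only finitely many arm sequences carry mass, so the mass of any set is a finite sum of
  measurable point masses.\<close>

lemma run_kernel_measurable:
  assumes "is_bandit_algorithm \<pi>" "1 \<le> K" "{1..K} \<times> {1..T} \<subseteq> J"
    and "\<And>p. p \<in> {1..K} \<times> {1..T} \<Longrightarrow> sets (N p) = sets borel"
  shows "(\<lambda>x. measure_pmf (run (\<pi> T K) x T)) \<in> PiM J N \<rightarrow>\<^sub>M subprob_algebra (count_space UNIV)"
proof (rule measurable_subprob_algebra)
  fix A :: "nat list set"
  have "emeasure (measure_pmf (run (\<pi> T K) x T)) A =
          ennreal (\<Sum>as\<in>A \<inter> arm_seqs K T. pmf (run (\<pi> T K) x T) as)" for x
  proof -
    have "emeasure (measure_pmf (run (\<pi> T K) x T)) A =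
          emeasure (measure_pmf (run (\<pi> T K) x T)) (A \<inter> arm_seqs K T)"
      using set_run[OF assms(1,2), of T T x]
      by (intro emeasure_eq_AE) (auto simp: AE_measure_pmf_iff)
    then show ?thesis by (simp add: emeasure_measure_pmf_finite)
  qed
  then show "(\<lambda>x. emeasure (measure_pmf (run (\<pi> T K) x T)) A) \<in> borel_measurable (PiM J N)"
    by (auto intro!: measurable_compose[OF _ measurable_ennreal] borel_measurable_sum
        measurable_pmf_run[OF assms])
qed (auto intro: measure_pmf.subprob_space_axioms prob_space_imp_subprob_space measure_pmf.prob_space_axioms)

text \<open>The tower property: average first over the randomisation of the algorithm, then over the
  table. All later estimates can then be made for functions of the table alone.\<close>

lemma integral_arms_law:
  fixes f :: "nat list \<Rightarrow> real"
  assumes alg: "is_bandit_algorithm \<pi>" "1 \<le> K"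
    and sets: "\<And>i. i \<in> {1..K} \<Longrightarrow> sets (\<nu> i) = sets borel"
    and prob: "\<And>i. i \<in> {1..K} \<Longrightarrow> prob_space (\<nu> i)"
  shows "(\<integral>as. f as \<partial>arms_law \<pi> T K \<nu>) = (\<integral>x. arms_mean \<pi> T K f x \<partial>reward_table K \<nu>)"
proof -
  define R where "R = reward_table K \<nu>"
  interpret R: prob_space R
    unfolding R_def reward_table_def by (rule prob_space_PiM) (auto intro: prob)
  define \<kappa> where "\<kappa> x = measure_pmf (run (\<pi> T K) x T)" for x
  have law: "arms_law \<pi> T K \<nu> = R \<bind> \<kappa>"
    by (simp add: arms_law_def R_def \<kappa>_def[abs_def] map_fst_play)
  have \<kappa>: "\<kappa> \<in> R \<rightarrow>\<^sub>M subprob_algebra (count_space UNIV)"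
    unfolding R_def reward_table_def \<kappa>_def
    by (rule run_kernel_measurable[OF alg]) (auto simp: sets)
  have sets_law: "sets (R \<bind> \<kappa>) = sets (count_space UNIV)"
    using R.not_empty by (intro sets_bind) (auto simp: \<kappa>_def)
  have ae: "AE as in R \<bind> \<kappa>. as \<in> arm_seqs K T"
  proof (subst AE_bind[OF \<kappa>])
    have "AE as in \<kappa> x. as \<in> arm_seqs K T" for x
      unfolding \<kappa>_def using set_run[OF alg, of T T x] by (intro AE_pmfI) auto
    then show "AE x in R. AE as in \<kappa> x. as \<in> arm_seqs K T" by simp
  qed simp
  \<comment> \<open>\<open>integral_bind\<close> is applied with a global bound on the integrand,
    whereas \<open>f\<close> is bounded only on the finite set of feasible sequences. Cutting
    \<open>f\<close> off there changes nothing almost everywhere.\<close>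
  define g where "g as = f as * indicator (arm_seqs K T) as" for as
  define B where "B = Max (insert 0 ((\<lambda>as. \<bar>f as\<bar>) ` arm_seqs K T))"
  have gB: "\<bar>g as\<bar> \<le> B" for as
    by (auto simp: g_def B_def indicator_def)
  have "(\<integral>as. f as \<partial>(R \<bind> \<kappa>)) = (\<integral>as. g as \<partial>(R \<bind> \<kappa>))"
    using ae by (intro integral_cong_AE) (auto simp: g_def measurable_cong_sets[OF sets_law refl])
  also have "\<dots> = (\<integral>x. integral\<^sup>L (\<kappa> x) g \<partial>R)"
    using gB
    by (intro integral_bind[where K = "count_space UNIV" and B = B and B' = 1] \<kappa>)
      (auto simp: \<kappa>_def R.finite_measure_axioms)
  also have "\<dots> = (\<integral>x. arms_mean \<pi> T K f x \<partial>R)"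
  proof (rule Bochner_Integration.integral_cong)
    fix x
    have "integral\<^sup>L (\<kappa> x) g = (\<Sum>as\<in>arm_seqs K T. g as * pmf (run (\<pi> T K) x T) as)"
      unfolding \<kappa>_def by (rule integral_measure_pmf_real) (auto simp: g_def indicator_def)
    then show "integral\<^sup>L (\<kappa> x) g = arms_mean \<pi> T K f x"
      by (simp add: arms_mean_def g_def)
  qed simp
  finally show ?thesis by (simp add: law R_def)
qed

section \<open>Gaussian rewards and likelihood ratios\<close>

text \<open>
  A Hammersley--Chapman--Robbins bound. Instead of Cauchy--Schwarz it uses
  \<open>\<bar>u * v\<bar> \<le> u\<^sup>2 / (2 * s) + s * v\<^sup>2 / 2\<close>, which avoids square roots of integrals.
\<close>

lemma (in prob_space) chapman_robbins:
  fixes f L :: "'a \<Rightarrow> real"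
  assumes f [measurable]: "f \<in> borel_measurable M" and f_bound: "\<And>x. \<bar>f x\<bar> \<le> B"
    and L: "integrable M L" "expectation L = 1"
    and L2: "integrable M (\<lambda>x. (L x)\<^sup>2)" "expectation (\<lambda>x. (L x)\<^sup>2) \<le> 1 + c"
    and var: "expectation (\<lambda>x. (f x - expectation f)\<^sup>2) \<le> s\<^sup>2" and "s > 0"
  shows "\<bar>expectation (\<lambda>x. L x * f x) - expectation f\<bar> \<le> (1 + c) / 2 * s"
proof -
  note [measurable] = borel_measurable_integrable[OF L(1)]
  define m where "m = expectation f"
  have f_int: "integrable M f"
    by (rule integrable_const_bound[where B = B]) (auto simp: f_bound)
  have Lf_int: "integrable M (\<lambda>x. L x * f x)"
  proof (rule Bochner_Integration.integrable_bound)
    show "integrable M (\<lambda>x. B * L x)" using L by simp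
    have "norm (L x * f x) \<le> norm (B * L x)" for x
    proof -
      have "\<bar>L x\<bar> * \<bar>f x\<bar> \<le> \<bar>L x\<bar> * \<bar>B\<bar>"
        using f_bound[of x] by (intro mult_left_mono) auto
      then show ?thesis by (simp add: abs_mult mult.commute)
    qed
    then show "AE x in M. norm (L x * f x) \<le> norm (B * L x)" by simp
  qed simp
  have f2_int: "integrable M (\<lambda>x. (f x - m)\<^sup>2)"
  proof (rule integrable_const_bound[where B = "(B + \<bar>m\<bar>)\<^sup>2"])
    have "\<bar>f x - m\<bar> \<le> B + \<bar>m\<bar>" for x using f_bound[of x] by linarith
    from power_mono[OF this abs_ge_zero, where n = 2]
    show "AE x in M. norm ((f x - m)\<^sup>2) \<le> (B + \<bar>m\<bar>)\<^sup>2" by simp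
  qed simp
  have L1_int: "integrable M (\<lambda>x. (L x - 1)\<^sup>2)"
    using L L2 by (simp add: power2_diff)
  have L1: "expectation (\<lambda>x. (L x - 1)\<^sup>2) \<le> c"
    using L L2 by (simp add: power2_diff prob_space)
  \<comment> \<open>Since \<open>L - 1\<close> has mean zero, \<open>f\<close> may be centred at
    \<open>m\<close> for free; this is what brings in the variance of \<open>f\<close>.\<close>
  have "expectation (\<lambda>x. L x * f x) - m = expectation (\<lambda>x. (L x - 1) * (f x - m))"
    using L f_int Lf_int by (simp add: algebra_simps prob_space m_def)
  also have "\<bar>\<dots>\<bar> \<le> expectation (\<lambda>x. \<bar>(L x - 1) * (f x - m)\<bar>)"
    by (rule integral_abs_bound)
  also have "\<dots> \<le> expectation (\<lambda>x. (f x - m)\<^sup>2 / (2 * s) + s / 2 * (L x - 1)\<^sup>2)"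
  proof (rule integral_mono')
    fix x
    have "0 \<le> (\<bar>f x - m\<bar> - s * \<bar>L x - 1\<bar>)\<^sup>2" by simp
    also have "\<dots> = (f x - m)\<^sup>2 - 2 * s * \<bar>(L x - 1) * (f x - m)\<bar> + s\<^sup>2 * (L x - 1)\<^sup>2"
      by (simp add: power2_diff power_mult_distrib abs_mult mult_ac)
    finally show "\<bar>(L x - 1) * (f x - m)\<bar> \<le> (f x - m)\<^sup>2 / (2 * s) + s / 2 * (L x - 1)\<^sup>2"
      using \<open>s > 0\<close> by (simp add: field_simps power2_eq_square[of s])
  qed (use f2_int L1_int \<open>s > 0\<close> in auto)
  also have "\<dots> = expectation (\<lambda>x. (f x - m)\<^sup>2) / (2 * s) + s / 2 * expectation (\<lambda>x. (L x - 1)\<^sup>2)"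
    using f2_int L1_int by simp
  also have "\<dots> \<le> s\<^sup>2 / (2 * s) + s / 2 * c"
    using var L1 \<open>s > 0\<close> by (intro add_mono divide_right_mono mult_left_mono) (auto simp: m_def)
  also have "\<dots> = (1 + c) / 2 * s"
    using \<open>s > 0\<close> by (simp add: field_simps power2_eq_square)
  finally show ?thesis by (simp add: m_def)
qed

text \<open>A product measure is determined by its values on rectangles, and on a rectangle the
  integral of the product density factorises over the coordinates.\<close>

lemma PiM_density:
  fixes g :: "'i \<Rightarrow> 'a \<Rightarrow> ennreal"
  assumes "finite I" and M: "\<And>i. prob_space (M i)"
    and gM: "\<And>i. prob_space (density (M i) (g i))"
    and g [measurable]: "\<And>i. g i \<in> borel_measurable (M i)"
  shows "PiM I (\<lambda>i. density (M i) (g i)) = density (PiM I M) (\<lambda>x. \<Prod>i\<in>I. g i (x i))"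
proof -
  interpret product_prob_space M I
    using M by (simp add: product_prob_space_def product_prob_space_axioms_def product_sigma_finite_def
        prob_space_imp_sigma_finite)
  interpret D: product_prob_space "\<lambda>i. density (M i) (g i)" I
    using gM by (simp add: product_prob_space_def product_prob_space_axioms_def product_sigma_finite_def
        prob_space_imp_sigma_finite)
  show ?thesis
  proof (rule D.PiM_eqI[symmetric])
    show "sets (density (PiM I M) (\<lambda>x. \<Prod>i\<in>I. g i (x i))) = sets (PiM I (\<lambda>i. density (M i) (g i)))"
      by (simp cong: sets_PiM_cong)
    fix A assume A: "\<And>i. i \<in> I \<Longrightarrow> A i \<in> sets (density (M i) (g i))"
    then have [measurable]: "Pi\<^sub>E I A \<in> sets (PiM I M)"
      using \<open>finite I\<close> by (auto intro!: sets_PiM_I_finite)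
    have "emeasure (density (PiM I M) (\<lambda>x. \<Prod>i\<in>I. g i (x i))) (Pi\<^sub>E I A) =
            (\<integral>\<^sup>+x. (\<Prod>i\<in>I. g i (x i)) * indicator (Pi\<^sub>E I A) x \<partial>PiM I M)"
      using \<open>finite I\<close> by (subst emeasure_density) auto
    also have "\<dots> = (\<integral>\<^sup>+x. (\<Prod>i\<in>I. g i (x i) * indicator (A i) (x i)) \<partial>PiM I M)"
    proof (rule nn_integral_cong)
      fix x assume "x \<in> space (PiM I M)"
      then have "indicator (Pi\<^sub>E I A) x = (\<Prod>i\<in>I. indicator (A i) (x i) :: ennreal)"
        using \<open>finite I\<close>
        by (auto simp: indicator_def PiE_iff space_PiM prod_zero_iff intro!: prod.neutral)
      then show "(\<Prod>i\<in>I. g i (x i)) * indicator (Pi\<^sub>E I A) x = (\<Prod>i\<in>I. g i (x i) * indicator (A i) (x i))"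
        by (simp add: prod.distrib)
    qed
    also have "\<dots> = (\<Prod>i\<in>I. \<integral>\<^sup>+y. g i y * indicator (A i) y \<partial>M i)"
      using A \<open>finite I\<close> by (intro product_nn_integral_prod) auto
    also have "\<dots> = (\<Prod>i\<in>I. emeasure (density (M i) (g i)) (A i))"
      using A by (intro prod.cong) (auto simp: emeasure_density)
    finally show "emeasure (density (PiM I M) (\<lambda>x. \<Prod>i\<in>I. g i (x i))) (Pi\<^sub>E I A) =
        (\<Prod>i\<in>I. emeasure (density (M i) (g i)) (A i))" .
  qed fact
qed

section \<open>Normal laws and shifts of their mean\<close>

abbreviation normal_law :: "real \<Rightarrow> real \<Rightarrow> real measure" where
  "normal_law \<sigma> \<mu> \<equiv> density lborel (normal_density \<mu> \<sigma>)"

text \<open>Completing the square: exponential tilting moves the mean and leaves the variance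
  unchanged. Both the moment generating function and the likelihood ratio of a shift are read off
  from this.\<close>

lemma normal_density_tilt:
  assumes "\<sigma> > 0"
  shows "normal_density \<mu> \<sigma> x * exp (l * (x - \<mu>)) =
           exp (l\<^sup>2 * \<sigma>\<^sup>2 / 2) * normal_density (\<mu> + l * \<sigma>\<^sup>2) \<sigma> x"
proof -
  have "- (x - \<mu>)\<^sup>2 / (2 * \<sigma>\<^sup>2) + l * (x - \<mu>) =
          l\<^sup>2 * \<sigma>\<^sup>2 / 2 + - (x - (\<mu> + l * \<sigma>\<^sup>2))\<^sup>2 / (2 * \<sigma>\<^sup>2)"
    using assms by (simp add: field_simps power2_eq_square)
  then show ?thesis
    by (simp add: normal_density_def flip: exp_add)
qed

lemma normal_law_mgf:
  assumes "\<sigma> > 0"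
  shows "has_bochner_integral (normal_law \<sigma> \<mu>) (\<lambda>x. exp (l * (x - \<mu>))) (exp (l\<^sup>2 * \<sigma>\<^sup>2 / 2))"
  using assms
  by (simp add: has_bochner_integral_iff integrable_density integral_density normal_density_tilt)

lemma mean_normal_law:
  assumes "\<sigma> > 0"
  shows "mean (normal_law \<sigma> \<mu>) = \<mu>"
  using normal_moment_nz_1[OF assms, of \<mu>]
  by (simp add: mean_def integral_density has_bochner_integral_iff)

lemma sub_Gaussian_normal_law:
  assumes "\<sigma> > 0"
  shows "sub_Gaussian \<sigma> (normal_law \<sigma> \<mu>)"
  using normal_law_mgf[OF assms, of \<mu>] normal_moment_nz_1[OF assms, of \<mu>]
    prob_space_normal_density[OF assms]
  by (simp add: sub_Gaussian_def mean_normal_law[OF assms] has_bochner_integral_iff integrable_density)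

text \<open>The likelihood ratio of the normal law with mean \<open>\<mu> + \<delta>\<close> against
  that with mean \<open>\<mu>\<close>, both of variance \<open>\<sigma>\<^sup>2\<close>.\<close>

definition shift_ratio :: "real \<Rightarrow> real \<Rightarrow> real \<Rightarrow> real \<Rightarrow> real" where
  "shift_ratio \<sigma> \<mu> \<delta> x = exp (\<delta> / \<sigma>\<^sup>2 * (x - \<mu>) - \<delta>\<^sup>2 / (2 * \<sigma>\<^sup>2))"

lemma shift_ratio_nonneg [simp]: "0 \<le> shift_ratio \<sigma> \<mu> \<delta> x"
  by (simp add: shift_ratio_def)

lemma shift_ratio_measurable [measurable]: "shift_ratio \<sigma> \<mu> \<delta> \<in> borel_measurable borel"
  by (simp add: shift_ratio_def[abs_def])

lemma normal_law_shift:
  assumes "\<sigma> > 0"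
  shows "normal_law \<sigma> (\<mu> + \<delta>) = density (normal_law \<sigma> \<mu>) (shift_ratio \<sigma> \<mu> \<delta>)"
proof -
  have "normal_density (\<mu> + \<delta>) \<sigma> x = normal_density \<mu> \<sigma> x * shift_ratio \<sigma> \<mu> \<delta> x" for x
  proof -
    have "(\<delta> / \<sigma>\<^sup>2)\<^sup>2 * \<sigma>\<^sup>2 / 2 = \<delta>\<^sup>2 / (2 * \<sigma>\<^sup>2)"
      using assms by (simp add: field_simps power2_eq_square)
    then show ?thesis
      using normal_density_tilt[OF assms, of \<mu> x "\<delta> / \<sigma>\<^sup>2"] assms
      by (simp add: shift_ratio_def exp_diff mult_ac)
  qed
  then show ?thesis
    by (subst density_density_eq) (auto simp: ennreal_mult)
qed

text \<open>Both are values of the moment generating function, at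
  \<open>\<delta> / \<sigma>\<^sup>2\<close> and at twice that. The second moment is one plus the
  chi-square divergence between the two laws.\<close>

lemma shift_ratio_moments:
  assumes "\<sigma> > 0"
  shows "has_bochner_integral (normal_law \<sigma> \<mu>) (shift_ratio \<sigma> \<mu> \<delta>) 1"
    and "has_bochner_integral (normal_law \<sigma> \<mu>) (\<lambda>x. (shift_ratio \<sigma> \<mu> \<delta> x)\<^sup>2) (exp (\<delta>\<^sup>2 / \<sigma>\<^sup>2))"
proof -
  have 1: "exp ((\<delta> / \<sigma>\<^sup>2)\<^sup>2 * \<sigma>\<^sup>2 / 2) / exp (\<delta>\<^sup>2 / (2 * \<sigma>\<^sup>2)) = 1"
    using assms by (simp add: field_simps power2_eq_square)
  show "has_bochner_integral (normal_law \<sigma> \<mu>) (shift_ratio \<sigma> \<mu> \<delta>) 1"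
    using has_bochner_integral_divide_zero[OF normal_law_mgf[OF assms, of \<mu> "\<delta> / \<sigma>\<^sup>2"], of "exp (\<delta>\<^sup>2 / (2 * \<sigma>\<^sup>2))"]
    unfolding 1 by (simp add: shift_ratio_def[abs_def] exp_diff)
  have "exp ((2 * \<delta> / \<sigma>\<^sup>2)\<^sup>2 * \<sigma>\<^sup>2 / 2) / exp (\<delta>\<^sup>2 / \<sigma>\<^sup>2) = exp (\<delta>\<^sup>2 / \<sigma>\<^sup>2)"
    using assms by (simp add: field_simps power2_eq_square flip: exp_add exp_diff)
  moreover have "(shift_ratio \<sigma> \<mu> \<delta> x)\<^sup>2 = exp (2 * \<delta> / \<sigma>\<^sup>2 * (x - \<mu>)) / exp (\<delta>\<^sup>2 / \<sigma>\<^sup>2)" for x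
    using assms by (simp add: shift_ratio_def field_simps power2_eq_square flip: exp_add exp_diff)
  ultimately show "has_bochner_integral (normal_law \<sigma> \<mu>) (\<lambda>x. (shift_ratio \<sigma> \<mu> \<delta> x)\<^sup>2) (exp (\<delta>\<^sup>2 / \<sigma>\<^sup>2))"
    using has_bochner_integral_divide_zero[OF normal_law_mgf[OF assms, of \<mu> "2 * \<delta> / \<sigma>\<^sup>2"], of "exp (\<delta>\<^sup>2 / \<sigma>\<^sup>2)"]
    by simp
qed

section \<open>Variability versus regret\<close>

definition reward_laws :: "nat \<Rightarrow> (nat \<Rightarrow> real measure) \<Rightarrow> bool" where
  "reward_laws K \<nu> \<longleftrightarrow> (\<forall>i\<in>{1..K}. prob_space (\<nu> i) \<and> sets (\<nu> i) = sets borel)"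

lemma arms_mean_table_measurable:
  assumes "is_bandit_algorithm \<pi>" "1 \<le> K" "reward_laws K \<nu>"
  shows "arms_mean \<pi> T K f \<in> borel_measurable (reward_table K \<nu>)"
  unfolding reward_table_def
  using assms by (intro arms_mean_measurable) (auto simp: reward_laws_def)

lemma integrable_arms_mean:
  assumes "is_bandit_algorithm \<pi>" "1 \<le> K" "reward_laws K \<nu>"
  shows "integrable (reward_table K \<nu>) (arms_mean \<pi> T K f)"
proof -
  interpret prob_space "reward_table K \<nu>"
    unfolding reward_table_def using assms
    by (intro prob_space_PiM) (auto simp: reward_laws_def)
  define B where "B = Max (insert 0 ((\<lambda>as. \<bar>f as\<bar>) ` arm_seqs K T))"
  have "f as \<in> {-B..B}" if "as \<in> arm_seqs K T" for as
  proof -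
    have "\<bar>f as\<bar> \<le> B" using that by (simp add: B_def)
    then show ?thesis by auto
  qed
  then have "arms_mean \<pi> T K f x \<in> {-B..B}" for x
    by (rule arms_mean_bounds[OF assms(1,2)])
  then have "\<bar>arms_mean \<pi> T K f x\<bar> \<le> B" for x
    by (simp add: abs_le_iff) (metis minus_le_iff)
  then show ?thesis
    by (intro integrable_const_bound[where B = B] arms_mean_table_measurable assms) auto
qed

lemma integral_arms_law_bounds:
  fixes f :: "nat list \<Rightarrow> real"
  assumes "is_bandit_algorithm \<pi>" "1 \<le> K" "reward_laws K \<nu>"
    and "\<And>as. as \<in> arm_seqs K T \<Longrightarrow> f as \<in> {a..b}"
  shows "(\<integral>as. f as \<partial>arms_law \<pi> T K \<nu>) \<in> {a..b}"
proof -
  interpret prob_space "reward_table K \<nu>"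
    unfolding reward_table_def using assms
    by (intro prob_space_PiM) (auto simp: reward_laws_def)
  have "arms_mean \<pi> T K f x \<in> {a..b}" for x
    by (rule arms_mean_bounds[OF assms(1,2,4)])
  then show ?thesis
    using integral_ge_const[OF integrable_arms_mean[OF assms(1-3)], of a T f]
      integral_le_const[OF integrable_arms_mean[OF assms(1-3)], of T f b] assms
    by (subst integral_arms_law) (auto simp: reward_laws_def)
qed

lemma expected_pulls_bounds:
  assumes "is_bandit_algorithm \<pi>" "1 \<le> K" "reward_laws K \<nu>"
  shows "expected_pulls \<pi> T K \<nu> i \<in> {0..real T}"
  unfolding expected_pulls_def
  by (rule integral_arms_law_bounds[OF assms])
    (use pulls_le_length[of i] in \<open>auto simp: arm_seqs_def\<close>)

lemma variance_pulls_bounds: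
  assumes "is_bandit_algorithm \<pi>" "1 \<le> K" "reward_laws K \<nu>"
  shows "variance_pulls \<pi> T K \<nu> i \<in> {0..(real T)\<^sup>2}"
proof -
  have "(real (pulls i as) - expected_pulls \<pi> T K \<nu> i)\<^sup>2 \<in> {0..(real T)\<^sup>2}"
    if "as \<in> arm_seqs K T" for as
  proof -
    have "\<bar>real (pulls i as) - expected_pulls \<pi> T K \<nu> i\<bar> \<le> real T"
      using that pulls_le_length[of i as] expected_pulls_bounds[OF assms, of T i]
      by (auto simp: arm_seqs_def)
    then show ?thesis by (simp add: abs_le_square_iff[symmetric])
  qed
  from integral_arms_law_bounds[OF assms this] show ?thesis
    by (simp add: variance_pulls_def expected_pulls_def)
qed

text \<open>By \<open>run_restrict\<close> the integrand depends only on the first \<open>T\<close>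
  columns, and the marginal of the infinite product on those columns is the finite product.\<close>

lemma integral_arms_mean_restrict:
  assumes "is_bandit_algorithm \<pi>" "1 \<le> K"
    and \<nu>: "\<And>i. prob_space (\<nu> i)" "\<And>i. sets (\<nu> i) = sets borel"
  shows "(\<integral>x. arms_mean \<pi> T K f x \<partial>reward_table K \<nu>) =
           (\<integral>x. arms_mean \<pi> T K f x \<partial>(\<Pi>\<^sub>M (i, s)\<in>{1..K} \<times> {1..T}. \<nu> i))"
proof -
  let ?N = "\<lambda>(i, s). \<nu> i"
  let ?J = "{1..K} \<times> {1..T}"
  let ?I = "{1..K} \<times> {1..} :: (nat \<times> nat) set"
  interpret product_prob_space ?N ?I
    using \<nu> by (simp add: product_prob_space_def product_prob_space_axioms_def product_sigma_finite_def
        prob_space_imp_sigma_finite split_beta)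
  have "distr (PiM ?I ?N) (PiM ?J ?N) (\<lambda>x. restrict x ?J) = PiM ?J ?N"
    by (rule distr_PiM_restrict_finite) auto
  then have "(\<integral>x. arms_mean \<pi> T K f x \<partial>PiM ?J ?N) =
               (\<integral>x. arms_mean \<pi> T K f x \<partial>distr (PiM ?I ?N) (PiM ?J ?N) (\<lambda>x. restrict x ?J))"
    by simp
  also have "\<dots> = (\<integral>x. arms_mean \<pi> T K f (restrict x ?J) \<partial>PiM ?I ?N)"
    using assms by (intro integral_distr arms_mean_measurable measurable_restrict_subset) auto
  also have "\<dots> = (\<integral>x. arms_mean \<pi> T K f x \<partial>PiM ?I ?N)"
    using run_restrict[OF assms(1,2) order_refl, of T T] by (simp add: arms_mean_def)
  finally show ?thesis by (simp add: reward_table_def)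
qed

section \<open>Comparison of neighbouring two-armed Gaussian instances\<close>

definition two_arms :: "real \<Rightarrow> real \<Rightarrow> nat \<Rightarrow> real measure" where
  "two_arms \<sigma> \<theta> i = normal_law \<sigma> (if i = 1 then \<theta> else 0)"

text \<open>The first two facts cover every index \<open>i\<close>, including those that name no
  arm, because the product locales ask for a probability space at each index.\<close>

lemma two_arms_laws:
  assumes "\<sigma> > 0"
  shows "prob_space (two_arms \<sigma> \<theta> i)" "sets (two_arms \<sigma> \<theta> i) = sets borel" "reward_laws K (two_arms \<sigma> \<theta>)"
  using assms by (auto simp: two_arms_def reward_laws_def prob_space_normal_density)

lemma atLeastAtMost_1_2: "{Suc 0..2} = {1, 2}"
  by auto

text \<open>
  Only the first \<open>T\<close> rewards of each arm are ever read, so the laws can be compared on the finite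
  table \<open>{1..2} \<times> {1..T}\<close>. There the likelihood ratio \<open>L\<close> is a plain product over the first row, and
  no adaptive chain rule for the history is needed.
\<close>

lemma expected_pulls_shift:
  assumes alg: "is_bandit_algorithm \<pi>" and "\<sigma> > 0"
    and \<delta>: "real T * \<delta>\<^sup>2 \<le> \<sigma>\<^sup>2"
    and "s > 0" and var: "variance_pulls \<pi> T 2 (two_arms \<sigma> \<theta>) i \<le> s\<^sup>2"
  shows "\<bar>expected_pulls \<pi> T 2 (two_arms \<sigma> (\<theta> + \<delta>)) i - expected_pulls \<pi> T 2 (two_arms \<sigma> \<theta>) i\<bar> \<le> 3 / 2 * s"
proof -
  note laws = two_arms_laws[OF \<open>\<sigma> > 0\<close>]
  define J :: "(nat \<times> nat) set" where "J = {1..2} \<times> {1..T}"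
  define N where "N = (\<lambda>(i, s::nat). two_arms \<sigma> \<theta> i)"
  define N' where "N' = (\<lambda>(i, s::nat). two_arms \<sigma> (\<theta> + \<delta>) i)"
  \<comment> \<open>Only arm 1 changes its law between the two instances, so the entries of arm 2
    contribute the factor 1.\<close>
  define h where "h p y = (if fst p = 1 then shift_ratio \<sigma> \<theta> \<delta> y else 1)" for p :: "nat \<times> nat" and y
  define L where "L x = (\<Prod>p\<in>J. h p (x p))" for x
  define F where "F = arms_mean \<pi> T 2 (\<lambda>as. real (pulls i as))"
  have [simp]: "finite J" by (simp add: J_def)
  have N: "prob_space (N p)" "sets (N p) = sets borel" for p
    by (auto simp: N_def laws split: prod.split)
  have h [measurable]: "h p \<in> borel_measurable (N p)" for p
    by (simp add: h_def[abs_def] measurable_cong_sets[OF N(2) refl])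
  have h_nonneg: "0 \<le> h p y" for p y by (simp add: h_def)
  have N': "N' = (\<lambda>p. density (N p) (\<lambda>y. ennreal (h p y)))"
    using normal_law_shift[OF \<open>\<sigma> > 0\<close>, of \<theta> \<delta>]
    by (auto simp: fun_eq_iff N_def N'_def h_def two_arms_def density_1)
  interpret product_prob_space N J
    using N by (simp add: product_prob_space_def product_prob_space_axioms_def product_sigma_finite_def
        prob_space_imp_sigma_finite)
  have "prob_space (density (N p) (\<lambda>y. ennreal (h p y)))" for p
    unfolding N'[THEN fun_cong, symmetric] by (auto simp: N'_def laws split: prod.split)
  from PiM_density[OF \<open>finite J\<close> N(1) this] have dens: "PiM J N' = density (PiM J N) (\<lambda>x. ennreal (L x))"
    by (simp add: N' L_def prod_ennreal h_nonneg)
  have N_const: "has_bochner_integral (N p) (\<lambda>_. 1 :: real) 1" for p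
    by (simp add: has_bochner_integral_iff M.prob_space)
  have N_fst: "N p = normal_law \<sigma> \<theta>" if "fst p = 1" for p
    using that by (simp add: N_def two_arms_def split_beta)
  have h1: "has_bochner_integral (N p) (h p) 1" for p
    using shift_ratio_moments(1)[OF \<open>\<sigma> > 0\<close>, of \<theta> \<delta>] N_const[of p] N_fst[of p]
    by (cases "fst p = 1") (simp_all add: h_def[abs_def])
  have h2: "has_bochner_integral (N p) (\<lambda>y. (h p y)\<^sup>2) (if fst p = 1 then exp (\<delta>\<^sup>2 / \<sigma>\<^sup>2) else 1)" for p
    using shift_ratio_moments(2)[OF \<open>\<sigma> > 0\<close>, of \<theta> \<delta>] N_const[of p] N_fst[of p]
    by (cases "fst p = 1") (simp_all add: h_def[abs_def])
  have L: "integrable (PiM J N) L" "expectation L = 1"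
    unfolding L_def[abs_def] using h1
    by (simp_all add: product_integrable_prod product_integral_prod has_bochner_integral_iff)
  have L2_eq: "(L x)\<^sup>2 = (\<Prod>p\<in>J. (h p (x p))\<^sup>2)" for x
    by (simp add: L_def prod_power_distrib)
  have L2: "integrable (PiM J N) (\<lambda>x. (L x)\<^sup>2)"
    unfolding L2_eq using h2
    by (intro product_integrable_prod) (auto simp: has_bochner_integral_iff)
  have "expectation (\<lambda>x. (L x)\<^sup>2) = (\<Prod>p\<in>J. if fst p = 1 then exp (\<delta>\<^sup>2 / \<sigma>\<^sup>2) else 1)"
    unfolding L2_eq using h2
    by (subst product_integral_prod) (auto simp: has_bochner_integral_iff)
  also have "\<dots> = (\<Prod>i\<in>{1..2::nat}. \<Prod>s\<in>{1..T}. if i = 1 then exp (\<delta>\<^sup>2 / \<sigma>\<^sup>2) else 1)"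
    unfolding J_def prod.cartesian_product by (intro prod.cong) auto
  also have "\<dots> = exp (real T * \<delta>\<^sup>2 / \<sigma>\<^sup>2)"
    by (simp add: atLeastAtMost_1_2 exp_of_nat_mult[symmetric])
  also have "\<dots> \<le> exp 1"
    using \<delta> \<open>\<sigma> > 0\<close> by (simp add: divide_simps)
  \<comment> \<open>Thus \<open>c = 2\<close> in \<open>chapman_robbins\<close>, whose factor
    \<open>(1 + c) / 2\<close> becomes the \<open>3 / 2\<close> of the conclusion.\<close>
  also have "\<dots> \<le> 3" by (rule exp_le)
  finally have L2_le: "expectation (\<lambda>x. (L x)\<^sup>2) \<le> 1 + 2" by simp
  have F_meas: "F \<in> borel_measurable (PiM J N)"
    unfolding F_def J_def by (rule arms_mean_measurable[OF alg]) (auto simp: N)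
  have law_eq: "(\<integral>as. f as \<partial>arms_law \<pi> T 2 (two_arms \<sigma> \<theta>)) = expectation (arms_mean \<pi> T 2 f)"
    for f :: "nat list \<Rightarrow> real"
    using integral_arms_law[OF alg, of 2 "two_arms \<sigma> \<theta>" T f]
      integral_arms_mean_restrict[OF alg, of 2 "two_arms \<sigma> \<theta>" T f]
    by (simp add: laws J_def N_def)
  have F_exp: "expected_pulls \<pi> T 2 (two_arms \<sigma> \<theta>) i = expectation F"
    by (simp add: expected_pulls_def law_eq F_def)
  have L_meas: "L \<in> borel_measurable (PiM J N)"
    using L(1) by (rule borel_measurable_integrable)
  have "expected_pulls \<pi> T 2 (two_arms \<sigma> (\<theta> + \<delta>)) i = integral\<^sup>L (PiM J N') F"
    using integral_arms_law[OF alg, of 2 "two_arms \<sigma> (\<theta> + \<delta>)" T "\<lambda>as. real (pulls i as)"]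
      integral_arms_mean_restrict[OF alg, of 2 "two_arms \<sigma> (\<theta> + \<delta>)" T "\<lambda>as. real (pulls i as)"]
    by (simp add: laws J_def N'_def F_def expected_pulls_def)
  also have "\<dots> = expectation (\<lambda>x. L x * F x)"
    unfolding dens using F_meas L_meas
    by (subst integral_density) (auto simp: L_def h_nonneg prod_nonneg)
  finally have F_exp': "expected_pulls \<pi> T 2 (two_arms \<sigma> (\<theta> + \<delta>)) i = expectation (\<lambda>x. L x * F x)" .
  have F_bound: "\<bar>F x\<bar> \<le> real T" for x
  proof -
    have "real (pulls i as) \<in> {0..real T}" if "as \<in> arm_seqs 2 T" for as
      using that pulls_le_length[of i as] by (simp add: arm_seqs_def)
    from arms_mean_bounds[OF alg _ this, where x = x] show ?thesis by (simp add: F_def)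
  qed
  let ?m = "expectation F"
  \<comment> \<open>\<open>F\<close> is the conditional mean of the pulls given the table. Its
    variance is at most that of the pulls, by Jensen's inequality for each table, so the bound
    \<open>s\<close> passes to \<open>F\<close>.\<close>
  have "expectation (\<lambda>x. (F x - ?m)\<^sup>2) \<le> expectation (arms_mean \<pi> T 2 (\<lambda>as. (real (pulls i as) - ?m)\<^sup>2))"
  proof (rule integral_mono')
    show "integrable (PiM J N) (arms_mean \<pi> T 2 (\<lambda>as. (real (pulls i as) - ?m)\<^sup>2))"
    proof (rule integrable_const_bound)
      have "(real (pulls i as) - ?m)\<^sup>2 \<in> {0..(real T)\<^sup>2}" if "as \<in> arm_seqs 2 T" for as
      proof -
        have "\<bar>real (pulls i as) - ?m\<bar> \<le> real T"
          using that pulls_le_length[of i as] expected_pulls_bounds[OF alg _ laws(3), of 2 T \<theta> i]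
          by (auto simp: arm_seqs_def F_exp)
        then show ?thesis by (simp add: abs_le_square_iff[symmetric])
      qed
      from arms_mean_bounds[OF alg _ this]
      show "AE x in PiM J N. norm (arms_mean \<pi> T 2 (\<lambda>as. (real (pulls i as) - ?m)\<^sup>2) x) \<le> (real T)\<^sup>2"
        by auto
      show "arms_mean \<pi> T 2 (\<lambda>as. (real (pulls i as) - ?m)\<^sup>2) \<in> borel_measurable (PiM J N)"
        unfolding J_def by (rule arms_mean_measurable[OF alg]) (auto simp: N)
    qed
    show "(F x - ?m)\<^sup>2 \<le> arms_mean \<pi> T 2 (\<lambda>as. (real (pulls i as) - ?m)\<^sup>2) x" for x
      unfolding F_def by (rule arms_mean_power2_le[OF alg]) simp
  qed (simp add: arms_mean_def sum_nonneg)
  also have "\<dots> = variance_pulls \<pi> T 2 (two_arms \<sigma> \<theta>) i"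
    using F_exp by (simp add: variance_pulls_def law_eq expected_pulls_def)
  finally have "expectation (\<lambda>x. (F x - ?m)\<^sup>2) \<le> s\<^sup>2" using var by simp
  from chapman_robbins[OF F_meas F_bound L L2 L2_le this \<open>s > 0\<close>]
  show ?thesis by (simp add: F_exp F_exp')
qed

text \<open>Telescoping over \<open>m\<close> equal shifts. The divergence is measured from the left
  end of each step, so the variance is controlled only at the points with
  \<open>j < m\<close>.\<close>

lemma expected_pulls_shift_chain:
  assumes alg: "is_bandit_algorithm \<pi>" and "\<sigma> > 0" and "real T * \<delta>\<^sup>2 \<le> \<sigma>\<^sup>2" and "s > 0"
    and "\<And>j. j < m \<Longrightarrow> variance_pulls \<pi> T 2 (two_arms \<sigma> (real j * \<delta>)) i \<le> s\<^sup>2"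
  shows "\<bar>expected_pulls \<pi> T 2 (two_arms \<sigma> (real m * \<delta>)) i - expected_pulls \<pi> T 2 (two_arms \<sigma> 0) i\<bar>
           \<le> real m * (3 / 2 * s)"
  using assms(5)
proof (induction m)
  case (Suc m)
  have *: "real (Suc m) * \<delta> = real m * \<delta> + \<delta>" by (simp add: algebra_simps)
  have "\<bar>expected_pulls \<pi> T 2 (two_arms \<sigma> (real m * \<delta>)) i - expected_pulls \<pi> T 2 (two_arms \<sigma> 0) i\<bar>
           \<le> real m * (3 / 2 * s)"
    using Suc by simp
  moreover have "\<bar>expected_pulls \<pi> T 2 (two_arms \<sigma> (real m * \<delta> + \<delta>)) i - expected_pulls \<pi> T 2 (two_arms \<sigma> (real m * \<delta>)) i\<bar> \<le> 3 / 2 * s"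
    using Suc.prems[of m] by (intro expected_pulls_shift assms(1-4)) auto
  moreover have "real (Suc m) * (3 / 2 * s) = real m * (3 / 2 * s) + 3 / 2 * s"
    by (simp add: algebra_simps)
  ultimately show ?case unfolding * by linarith
qed simp

section \<open>Worst-case quantities over the sub-Gaussian class\<close>

lemma two_arms_in_class:
  assumes "\<sigma> > 0" "\<bar>\<theta>\<bar> \<le> M" "2 \<le> Kbar"
  shows "(2, two_arms \<sigma> \<theta>) \<in> sub_Gaussian_class M \<sigma> Kbar"
  using assms
  by (auto simp: sub_Gaussian_class_def two_arms_def mean_normal_law sub_Gaussian_normal_law abs_le_iff)

lemma sub_Gaussian_classD:
  assumes "(K, \<nu>) \<in> sub_Gaussian_class M \<sigma> Kbar"
  shows "1 \<le> K" "2 \<le> K" "K \<le> Kbar" "reward_laws K \<nu>" "i \<in> {1..K} \<Longrightarrow> mean (\<nu> i) \<in> {-M..M}"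
  using assms by (auto simp: sub_Gaussian_class_def reward_laws_def sub_Gaussian_def)

lemma variability_bounds:
  assumes "is_bandit_algorithm \<pi>" "1 \<le> K" "reward_laws K \<nu>"
  shows "variability \<pi> T K \<nu> \<in> {0..real T}"
proof -
  have *: "sqrt (variance_pulls \<pi> T K \<nu> i) \<in> {0..real T}" for i
    using variance_pulls_bounds[OF assms, of T i] by (auto intro: real_le_lsqrt)
  have "Max ((\<lambda>i. sqrt (variance_pulls \<pi> T K \<nu> i)) ` {1..K}) \<in> (\<lambda>i. sqrt (variance_pulls \<pi> T K \<nu> i)) ` {1..K}"
    using assms(2) by (intro Max_in) auto
  then show ?thesis using * unfolding variability_def by auto
qed

lemma variance_pulls_le_variability:
  assumes "is_bandit_algorithm \<pi>" "1 \<le> K" "reward_laws K \<nu>" "i \<in> {1..K}"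
  shows "variance_pulls \<pi> T K \<nu> i \<le> (variability \<pi> T K \<nu>)\<^sup>2"
proof -
  have "sqrt (variance_pulls \<pi> T K \<nu> i) \<le> variability \<pi> T K \<nu>"
    unfolding variability_def using assms(4) by (intro Max_ge) auto
  then have "(sqrt (variance_pulls \<pi> T K \<nu> i))\<^sup>2 \<le> (variability \<pi> T K \<nu>)\<^sup>2"
    using variance_pulls_bounds[OF assms(1-3), of T i] by (intro power_mono) auto
  then show ?thesis using variance_pulls_bounds[OF assms(1-3), of T i] by simp
qed

text \<open>A supremum of reals dominates its members once the set is bounded above; here the common
  bound is \<open>real T\<close>.\<close>

lemma variability_le_worst:
  assumes "is_bandit_algorithm \<pi>" "(K, \<nu>) \<in> sub_Gaussian_class M \<sigma> Kbar"
  shows "variability \<pi> T K \<nu> \<le> worst_variability (sub_Gaussian_class M \<sigma> Kbar) \<pi> T"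
proof -
  have "bdd_above ((\<lambda>(K, \<nu>). variability \<pi> T K \<nu>) ` sub_Gaussian_class M \<sigma> Kbar)"
    using variability_bounds[OF assms(1) sub_Gaussian_classD(1,4)]
    by (intro bdd_aboveI[where M = "real T"]) auto
  from cSUP_upper[OF assms(2) this] show ?thesis
    by (simp add: worst_variability_def)
qed

text \<open>Every gap is at most \<open>2 * M\<close> and every arm is pulled at most
  \<open>T\<close> times. The resulting bound is crude, but it only has to show that the supremum is
  over a bounded set.\<close>

lemma regret_le_worst:
  assumes "is_bandit_algorithm \<pi>" "(K, \<nu>) \<in> sub_Gaussian_class M \<sigma> Kbar" "M > 0"
  shows "regret \<pi> T K \<nu> \<le> worst_regret (sub_Gaussian_class M \<sigma> Kbar) \<pi> T"
proof -
  have "regret \<pi> T K \<nu> \<le> real Kbar * (2 * M * real T)"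
    if c: "(K, \<nu>) \<in> sub_Gaussian_class M \<sigma> Kbar" for K \<nu>
  proof -
    note D = sub_Gaussian_classD[OF c]
    have "gap K \<nu> i * expected_pulls \<pi> T K \<nu> i \<le> 2 * M * real T" if "i \<in> {1..K}" for i
    proof -
      have "Max ((\<lambda>j. mean (\<nu> j)) ` {1..K}) \<le> M"
        using D by (intro Max.boundedI) auto
      then have "gap K \<nu> i \<le> 2 * M"
        using D(5)[OF that] by (simp add: gap_def)
      then show ?thesis
        using expected_pulls_bounds[OF assms(1) D(1,4), of T i] \<open>M > 0\<close> by (intro mult_mono) auto
    qed
    then have "regret \<pi> T K \<nu> \<le> real (card {1..K}) * (2 * M * real T)"
      unfolding regret_def by (rule sum_bounded_above)
    also have "\<dots> = real K * (2 * M * real T)" by simp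
    also have "\<dots> \<le> real Kbar * (2 * M * real T)"
      using D(3) \<open>M > 0\<close> by (intro mult_right_mono) auto
    finally show ?thesis .
  qed
  then have "bdd_above ((\<lambda>(K, \<nu>). regret \<pi> T K \<nu>) ` sub_Gaussian_class M \<sigma> Kbar)"
    by (intro bdd_aboveI[where M = "real Kbar * (2 * M * real T)"]) auto
  from cSUP_upper[OF assms(2) this] show ?thesis
    by (simp add: worst_regret_def)
qed

lemma worst_variability_bounds:
  assumes "is_bandit_algorithm \<pi>" "M > 0" "\<sigma> > 0" "2 \<le> Kbar"
  shows "worst_variability (sub_Gaussian_class M \<sigma> Kbar) \<pi> T \<in> {0..real T}"
proof -
  have c: "(2, two_arms \<sigma> 0) \<in> sub_Gaussian_class M \<sigma> Kbar"
    using assms by (intro two_arms_in_class) auto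
  have "0 \<le> worst_variability (sub_Gaussian_class M \<sigma> Kbar) \<pi> T"
    using variability_bounds[OF assms(1) sub_Gaussian_classD(1,4)[OF c], of T]
      variability_le_worst[OF assms(1) c, of T] by simp
  moreover have "worst_variability (sub_Gaussian_class M \<sigma> Kbar) \<pi> T \<le> real T"
    unfolding worst_variability_def
    using c variability_bounds[OF assms(1) sub_Gaussian_classD(1,4)]
    by (intro cSUP_least) auto
  ultimately show ?thesis by simp
qed

section \<open>Regret and symmetry with two arms\<close>

lemma regret_two_arms:
  assumes "\<sigma> > 0" "\<theta> \<ge> 0"
  shows "regret \<pi> T 2 (two_arms \<sigma> \<theta>) = \<theta> * expected_pulls \<pi> T 2 (two_arms \<sigma> \<theta>) 2"
  using assms by (simp add: regret_def gap_def atLeastAtMost_1_2 two_arms_def mean_normal_law)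

lemma pulls_two_arms: "set as \<subseteq> {1..2} \<Longrightarrow> pulls 1 as + pulls 2 as = length as"
  by (induction as) (auto simp: pulls_def)

text \<open>Every round pulls one of the two arms, so the two counts add up to \<open>T\<close> for
  every table, and hence in expectation.\<close>

lemma expected_pulls_identical_arms:
  assumes alg: "is_bandit_algorithm \<pi>" and laws: "reward_laws 2 \<nu>"
    and eq: "expected_pulls \<pi> T 2 \<nu> 1 = expected_pulls \<pi> T 2 \<nu> 2"
  shows "expected_pulls \<pi> T 2 \<nu> 2 = real T / 2"
proof -
  interpret prob_space "reward_table 2 \<nu>"
    unfolding reward_table_def using laws
    by (intro prob_space_PiM) (auto simp: reward_laws_def)
  let ?F = "\<lambda>i. arms_mean \<pi> T 2 (\<lambda>as. real (pulls i as))"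
  have E: "expected_pulls \<pi> T 2 \<nu> i = expectation (?F i)" for i
    unfolding expected_pulls_def using laws alg
    by (intro integral_arms_law) (auto simp: reward_laws_def)
  have "?F 1 x + ?F 2 x = real T" for x
  proof -
    have "?F 1 x + ?F 2 x = arms_mean \<pi> T 2 (\<lambda>as. real (pulls 1 as + pulls 2 as)) x"
      by (simp add: arms_mean_def sum.distrib[symmetric] algebra_simps)
    also have "\<dots> = arms_mean \<pi> T 2 (\<lambda>_. real T) x"
      unfolding arms_mean_def by (intro sum.cong) (auto simp: arm_seqs_def pulls_two_arms[simplified] simp flip: of_nat_add)
    finally show ?thesis using alg by (simp add: arms_mean_const)
  qed
  then have "expectation (?F 1) + expectation (?F 2) = real T"
    using alg laws
    by (subst Bochner_Integration.integral_add[symmetric]) (auto intro!: integrable_arms_mean simp: prob_space)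
  then show ?thesis using eq by (simp add: E)
qed

text \<open>The denominator is four times an upper bound on the number of steps. The condition
  \<open>8 * R / real T \<le> M\<close> keeps all instances along the chain inside the
  class.\<close>

lemma worst_variability_ge:
  assumes alg: "is_bandit_algorithm \<pi>" and pos: "M > 0" "\<sigma> > 0" and "2 \<le> Kbar"
    and sym: "treats_identical_arms_equally (sub_Gaussian_class M \<sigma> Kbar) \<pi>"
    and R: "worst_regret (sub_Gaussian_class M \<sigma> Kbar) \<pi> T \<le> R" "R > 0" "T > 0" "8 * R / real T \<le> M"
  shows "real T / (4 * (8 * R / (\<sigma> * sqrt (real T)) + 1))
           \<le> worst_variability (sub_Gaussian_class M \<sigma> Kbar) \<pi> T"
proof -
  let ?P = "sub_Gaussian_class M \<sigma> Kbar"
  let ?E = "\<lambda>\<theta>. expected_pulls \<pi> T 2 (two_arms \<sigma> \<theta>) 2"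
  \<comment> \<open>With gap \<open>\<Delta>\<close> the regret bound forces \<open>?E \<Delta> \<le> T / 8\<close>; each of the \<open>m\<close> steps has length at most \<open>\<sigma> / sqrt T\<close>.\<close>
  define S where "S = worst_variability ?P \<pi> T"
  define \<Delta> where "\<Delta> = 8 * R / real T"
  define m where "m = nat \<lceil>\<Delta> * sqrt (real T) / \<sigma>\<rceil>"
  define \<delta> where "\<delta> = \<Delta> / real m"
  have "\<Delta> > 0" using R by (simp add: \<Delta>_def)
  then have ratio_pos: "\<Delta> * sqrt (real T) / \<sigma> > 0" using R pos by simp
  then have "m > 0" by (simp add: m_def)
  have m_ge: "\<Delta> * sqrt (real T) / \<sigma> \<le> real m"
    unfolding m_def by (rule real_nat_ceiling_ge)
  have m_le: "real m \<le> \<Delta> * sqrt (real T) / \<sigma> + 1"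
    using ratio_pos unfolding m_def by linarith
  have "sqrt (real T) * \<delta> \<le> \<sigma>"
    using m_ge \<open>m > 0\<close> pos by (simp add: \<delta>_def field_simps)
  then have "(sqrt (real T) * \<delta>)\<^sup>2 \<le> \<sigma>\<^sup>2"
    using \<open>\<Delta> > 0\<close> by (intro power_mono) (auto simp: \<delta>_def)
  then have \<delta>: "real T * \<delta>\<^sup>2 \<le> \<sigma>\<^sup>2" by (simp add: power_mult_distrib)
  have m\<delta>: "real m * \<delta> = \<Delta>" using \<open>m > 0\<close> by (simp add: \<delta>_def)
  have in_class: "(2, two_arms \<sigma> \<theta>) \<in> ?P" if "0 \<le> \<theta>" "\<theta> \<le> \<Delta>" for \<theta>
    using that R pos \<open>2 \<le> Kbar\<close> by (intro two_arms_in_class) (auto simp: \<Delta>_def)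
  have "\<Delta> * ?E \<Delta> \<le> R"
    using regret_le_worst[OF alg in_class[of \<Delta>] pos(1), of T] R pos \<open>\<Delta> > 0\<close>
    by (simp add: regret_two_arms)
  then have E\<Delta>: "?E \<Delta> \<le> real T / 8"
    using R by (simp add: \<Delta>_def field_simps)
  have "two_arms \<sigma> 0 1 = two_arms \<sigma> 0 2" by (simp add: two_arms_def)
  then have "expected_pulls \<pi> T 2 (two_arms \<sigma> 0) 1 = ?E 0"
    using sym[unfolded treats_identical_arms_equally_def, rule_format, OF in_class[of 0]] \<open>\<Delta> > 0\<close>
    by auto
  then have E0: "?E 0 = real T / 2"
    by (rule expected_pulls_identical_arms[OF alg two_arms_laws(3)[OF pos(2)]])
  \<comment> \<open>The chain needs a strictly positive bound \<open>s\<close>, while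
    \<open>S\<close> is so far only known to be nonnegative. The estimate is therefore proved for
    every positive \<open>s\<close> above \<open>S\<close>.\<close>
  have S_ge: "real T / (4 * real m) \<le> s" if "s > 0" "S \<le> s" for s
  proof -
    have "variance_pulls \<pi> T 2 (two_arms \<sigma> (real j * \<delta>)) 2 \<le> s\<^sup>2" if "j < m" for j
    proof -
      have "real j * \<delta> \<le> real m * \<delta>"
        using that \<open>\<Delta> > 0\<close> by (intro mult_right_mono) (auto simp: \<delta>_def)
      then have c: "(2, two_arms \<sigma> (real j * \<delta>)) \<in> ?P"
        using \<open>\<Delta> > 0\<close> m\<delta> by (intro in_class) (auto simp: \<delta>_def)
      note laws = two_arms_laws(3)[OF pos(2)]
      have "variance_pulls \<pi> T 2 (two_arms \<sigma> (real j * \<delta>)) 2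
              \<le> (variability \<pi> T 2 (two_arms \<sigma> (real j * \<delta>)))\<^sup>2"
        by (rule variance_pulls_le_variability[OF alg _ laws]) auto
      also have "\<dots> \<le> s\<^sup>2"
        using variability_le_worst[OF alg c, of T] \<open>S \<le> s\<close>
          variability_bounds[OF alg _ laws, of 2 T "real j * \<delta>"]
        by (intro power_mono) (auto simp: S_def)
      finally show ?thesis .
    qed
    then have "\<bar>?E (real m * \<delta>) - ?E 0\<bar> \<le> real m * (3 / 2 * s)"
      by (rule expected_pulls_shift_chain[OF alg pos(2) \<delta> \<open>s > 0\<close>])
    then
    \<comment> \<open>From \<open>T / 2\<close> the expectation falls to at most
      \<open>T / 8\<close>; the drop of \<open>3 * T / 8\<close> against
      \<open>3 / 2 * m * s\<close> gives \<open>T / (4 * m)\<close>.\<close>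
    have "real T / 2 - real T / 8 \<le> real m * (3 / 2 * s)"
      using E0 E\<Delta> unfolding m\<delta> by linarith
    then show ?thesis using \<open>m > 0\<close> by (simp add: field_simps)
  qed
  have "real T / (4 * real m) \<le> S"
  \<comment> \<open>Taking \<open>s = S + e\<close> with arbitrary \<open>e > 0\<close> recovers the
    bound for \<open>S\<close> itself.\<close>
  proof (rule field_le_epsilon)
    fix e :: real assume "0 < e"
    then show "real T / (4 * real m) \<le> S + e"
      using worst_variability_bounds[OF alg pos \<open>2 \<le> Kbar\<close>, of T] by (intro S_ge) (auto simp: S_def)
  qed
  moreover have "real T / (4 * (8 * R / (\<sigma> * sqrt (real T)) + 1)) \<le> real T / (4 * real m)"
  proof -
    have "\<Delta> * sqrt (real T) / \<sigma> = 8 * R / (\<sigma> * sqrt (real T))"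
      using R pos by (simp add: \<Delta>_def field_simps)
    then show ?thesis using m_le \<open>m > 0\<close> by (intro divide_left_mono) auto
  qed
  ultimately show ?thesis by (simp add: S_def)
qed

text \<open>With \<open>R\<close> equal to a constant times \<open>sqrt T * ln T ^ k\<close>, the
  number of steps is of order at most \<open>ln T ^ k\<close>. The same exponent \<open>k\<close> is
  kept, so \<open>k = 0\<close> covers the case without logarithms.\<close>

lemma worst_variability_bigomega:
  assumes alg: "is_bandit_algorithm \<pi>" and pos: "M > 0" "\<sigma> > 0" and "2 \<le> Kbar"
    and sym: "treats_identical_arms_equally (sub_Gaussian_class M \<sigma> Kbar) \<pi>"
    and R: "worst_regret (sub_Gaussian_class M \<sigma> Kbar) \<pi> \<in> O(\<lambda>T. sqrt (real T) * ln (real T) ^ k)"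
  shows "worst_variability (sub_Gaussian_class M \<sigma> Kbar) \<pi> \<in> \<Omega>(\<lambda>T. real T / ln (real T) ^ k)"
proof -
  let ?P = "sub_Gaussian_class M \<sigma> Kbar"
  obtain C where C: "C > 0"
    "eventually (\<lambda>T. norm (worst_regret ?P \<pi> T) \<le> C * norm (sqrt (real T) * ln (real T) ^ k)) at_top"
    using landau_o.bigE[OF R] by blast
  have "(\<lambda>T::nat. 8 * C * ln (real T) ^ k / sqrt (real T)) \<longlonglongrightarrow> 0"
    by real_asymp
  \<comment> \<open>This is the requirement that the final gap \<open>8 * R / T\<close> stay below
    \<open>M\<close>, which holds for large \<open>T\<close>.\<close>
  then have small: "eventually (\<lambda>T::nat. 8 * C * ln (real T) ^ k / sqrt (real T) < M) at_top"
    using pos(1) by (rule order_tendstoD)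
  have ln1: "eventually (\<lambda>T::nat. ln (real T) \<ge> 1) at_top"
    by real_asymp
  \<comment> \<open>As the logarithmic factor \<open>l\<close> is at least 1,
    \<open>8 * C / \<sigma> * l + 1\<close> is at most \<open>(8 * C / \<sigma> + 1) * l\<close>,
    which lets \<open>l\<close> be pulled out of the denominator.\<close>
  define c where "c = 1 / (4 * (8 * C / \<sigma> + 1))"
  have "c > 0" using C pos by (simp add: c_def add_pos_pos)
  have "eventually (\<lambda>T. norm (worst_variability ?P \<pi> T) \<ge> c * norm (real T / ln (real T) ^ k)) at_top"
    using C(2) small ln1 eventually_gt_at_top[of 0]
  proof eventually_elim
    case (elim T)
    define l where "l = ln (real T) ^ k"
    have "l \<ge> 1" using elim by (simp add: l_def one_le_power)
    let ?R = "C * (sqrt (real T) * l)"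
    have "real T / (4 * (8 * ?R / (\<sigma> * sqrt (real T)) + 1)) \<le> worst_variability ?P \<pi> T"
    proof (rule worst_variability_ge[OF alg pos \<open>2 \<le> Kbar\<close> sym])
      show "worst_regret ?P \<pi> T \<le> ?R"
        using elim \<open>l \<ge> 1\<close> by (simp add: l_def[symmetric])
      show "?R > 0" using C elim \<open>l \<ge> 1\<close> by simp
      show "8 * ?R / real T \<le> M"
      proof -
        have "8 * ?R / real T = 8 * C * l / sqrt (real T)"
          using elim by (simp add: field_simps)
        then show ?thesis using elim by (simp add: l_def)
      qed
    qed fact
    moreover have "c * (real T / l) \<le> real T / (4 * (8 * ?R / (\<sigma> * sqrt (real T)) + 1))"
    proof -
      have eq: "8 * ?R / (\<sigma> * sqrt (real T)) = 8 * C / \<sigma> * l" using elim by simp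
      have "c * (real T / l) = real T / (4 * (8 * C / \<sigma> + 1) * l)"
        by (simp add: c_def)
      also have "\<dots> \<le> real T / (4 * (8 * C / \<sigma> * l + 1))"
        using \<open>l \<ge> 1\<close> C pos
        by (intro divide_left_mono mult_pos_pos add_nonneg_pos) (auto simp: algebra_simps)
      finally show ?thesis unfolding eq .
    qed
    ultimately show ?case
      using \<open>l \<ge> 1\<close> by (simp add: l_def[symmetric])
  qed
  then show ?thesis using \<open>c > 0\<close> by (intro landau_omega.bigI)
qed

theorem corollary1:
  fixes M \<sigma> :: real and Kbar :: nat and \<pi> :: bandit_algorithm
  defines "\<PP> \<equiv> sub_Gaussian_class M \<sigma> Kbar"
  assumes "M > 0" and "\<sigma> > 0" and "Kbar \<ge> 2"
    and "is_bandit_algorithm \<pi>"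
    and "treats_identical_arms_equally \<PP> \<pi>"
    and "pulls_every_arm \<PP> \<pi>"
  shows "(worst_regret \<PP> \<pi> \<in> soft_O (\<lambda>T. sqrt (real T)) \<longrightarrow>
            worst_variability \<PP> \<pi> \<in> soft_Theta (\<lambda>T. real T)) \<and>
         (worst_regret \<PP> \<pi> \<in> \<Theta>(\<lambda>T. sqrt (real T)) \<longrightarrow>
            worst_variability \<PP> \<pi> \<in> \<Theta>(\<lambda>T. real T))"
proof -
  have upper: "worst_variability \<PP> \<pi> \<in> O(\<lambda>T. real T)"
    using worst_variability_bounds[OF assms(5,2-4)] unfolding \<PP>_def
    by (intro landau_o.bigI[of 1]) auto
  have lower: "worst_variability \<PP> \<pi> \<in> \<Omega>(\<lambda>T. real T / ln (real T) ^ k)"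
    if "worst_regret \<PP> \<pi> \<in> O(\<lambda>T. sqrt (real T) * ln (real T) ^ k)" for k
    using worst_variability_bigomega[OF assms(5,2-4) assms(6)[unfolded \<PP>_def]] that
    unfolding \<PP>_def by blast
  have "worst_variability \<PP> \<pi> \<in> soft_Theta (\<lambda>T. real T)"
    if "worst_regret \<PP> \<pi> \<in> soft_O (\<lambda>T. sqrt (real T))"
  proof -
    have "worst_variability \<PP> \<pi> \<in> soft_O (\<lambda>T. real T)"
      using upper unfolding soft_O_def by (auto intro!: exI[of _ 0])
    then show ?thesis
      using that lower by (auto simp: soft_Theta_def soft_Omega_def soft_O_def[of "\<lambda>T. sqrt (real T)"])
  qed
  moreover have "worst_variability \<PP> \<pi> \<in> \<Theta>(\<lambda>T. real T)"
    if "worst_regret \<PP> \<pi> \<in> \<Theta>(\<lambda>T. sqrt (real T))"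
    \<comment> \<open>The exponent 0 makes the logarithmic factor equal to 1, so nothing is
      lost.\<close>
    using that upper lower[of 0] by (auto simp: bigtheta_def)
  ultimately show ?thesis by blast
qed

end
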